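(* Let $\alpha$ be an umbra and let $\kappa_\alpha$ be the cumulant umbra of $\alpha$. Then $$\alpha^n\simeq\kappa_\alpha(\kappa_\alpha+\alpha)^{n-1}$$ for every integer $n\ge1$.
   Context: Umbral calculus: $R$ is a commutative integral domain whose quotient field has characteristic zero; $A$ is a set (alphabet) whose elements are called umbrae; $E:R[A]\to R$ is a linear functional (evaluation) with $E[1]=1$ and $E[\alpha^i\gamma^j\cdots\delta^k]=E[\alpha^i]E[\gamma^j]\cdots E[\delta^k]$ for distinct umbrae and nonnegative integers $i,j,\dots,k$. The moments of $\alpha$ are $a_n=E[\alpha^n]$; its generating function (g.f.) is the formal power series $f(t)=1+\sum_{n\ge1}a_n t^n/n!$. For $p,q\in R[A]$, $p\simeq q$ means $E[p]=E[q]$; two umbrae are similar, $\alpha\equiv\gamma$, if $\alpha^n\simeq\gamma^n$ for all $n\ge0$. The alphabet is assumed saturated, i.e. it contains sufficiently many distinct umbrae similar to any expression considered, so that the auxiliary umbrae below exist as umbrae; they are defined up to similarity by their g.f. Dot-product: if $\alpha$ has g.f. $f(t)$ and $\gamma$ has g.f. $g(t)$, then $\gamma.\alpha$ is an auxiliary umbra with g.f. $g[\log f(t)]$. Singleton umbra $\chi$: $E[\chi^n]=\delta_{1,n}$ for $n\ge1$; its g.f. is $1+t$. Cumulant umbra: the cumulant of an umbra $\alpha$ is the umbra $\kappa_\alpha$ defined by $\kappa_\alpha\equiv\chi.\alpha$. Here $\kappa_\alpha$ and $\alpha$ are regarded as distinct (hence uncorrelated) umbrae. *)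

theory Defs
  imports
    "HOL-Library.Poly_Mapping"
    "HOL-Computational_Algebra.Computational_Algebra"
begin

text \<open>
  The alphabet is a type \<open>'a\<close>, and \<open>('a, 'r) umbral_poly\<close> is the polynomial ring over \<open>'r\<close> in the
  commuting indeterminates \<open>'a\<close>: finitely supported maps from monomials (finitely supported
  exponent vectors) to coefficients. The product is that of \<open>Poly_Mapping\<close>, i.e. convolution.
  An integral domain has a quotient field of characteristic zero iff it is itself of
  characteristic zero, so the ground ring has sort \<open>{idom, ring_char_0}\<close>.
\<close>

type_synonym ('a, 'r) umbral_poly = "('a \<Rightarrow>\<^sub>0 nat) \<Rightarrow>\<^sub>0 'r"

definition umbra :: "'a \<Rightarrow> ('a, 'r::comm_ring_1) umbral_poly" where
  "umbra \<alpha> = Poly_Mapping.single (Poly_Mapping.single \<alpha> 1) 1"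

definition scalar :: "'r::comm_ring_1 \<Rightarrow> ('a, 'r) umbral_poly" where
  "scalar c = Poly_Mapping.single 0 c"

locale evaluation =
  fixes E :: "('a, 'r::{idom, ring_char_0}) umbral_poly \<Rightarrow> 'r"
  assumes add: "E (p + q) = E p + E q"
    and scale: "E (scalar c * p) = c * E p"
    and one: "E 1 = 1"
    and uncorrelated:
      "finite S \<Longrightarrow> E (\<Prod>\<alpha>\<in>S. umbra \<alpha> ^ k \<alpha>) = (\<Prod>\<alpha>\<in>S. E (umbra \<alpha> ^ k \<alpha>))"

definition umbrally_equivalent ::
    "(('a, 'r::{idom, ring_char_0}) umbral_poly \<Rightarrow> 'r) \<Rightarrow>
      ('a, 'r) umbral_poly \<Rightarrow> ('a, 'r) umbral_poly \<Rightarrow> bool" where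
  "umbrally_equivalent E p q \<longleftrightarrow> E p = E q"

definition similar ::
    "(('a, 'r::{idom, ring_char_0}) umbral_poly \<Rightarrow> 'r) \<Rightarrow> 'a \<Rightarrow> 'a \<Rightarrow> bool" where
  "similar E \<alpha> \<gamma> \<longleftrightarrow> (\<forall>n. umbrally_equivalent E (umbra \<alpha> ^ n) (umbra \<gamma> ^ n))"

definition moment ::
    "(('a, 'r::{idom, ring_char_0}) umbral_poly \<Rightarrow> 'r) \<Rightarrow> 'a \<Rightarrow> nat \<Rightarrow> 'r" where
  "moment E \<alpha> n = E (umbra \<alpha> ^ n)"

instance fract :: ("{idom, ring_char_0}") field_char_0
proof
  show "inj (of_nat :: nat \<Rightarrow> 'a fract)"
    by (rule injI) (simp add: of_nat_fract eq_fract)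
qed

text \<open>Because of the factorials, generating functions live over the quotient field.\<close>

definition gen_fun ::
    "(('a, 'r::{idom, ring_char_0}) umbral_poly \<Rightarrow> 'r) \<Rightarrow> 'a \<Rightarrow> 'r fract fps" where
  "gen_fun E \<alpha> = 1 + Abs_fps (\<lambda>n. if n = 0 then 0 else to_fract (moment E \<alpha> n) / fact n)"

text \<open>\<open>fps_ln 1\<close> is the series of \<open>log (1 + t)\<close>; meaningful for \<open>f\<close> with constant term 1.\<close>

definition fps_log :: "'k::field_char_0 fps \<Rightarrow> 'k fps" where
  "fps_log f = fps_ln 1 oo (f - 1)"

text \<open>
  Auxiliary umbrae are determined only up to similarity, so the dot-product is a relation:
  \<open>dot_product E \<gamma> \<alpha> \<delta>\<close> says that the umbra \<open>\<delta>\<close> is a representative of \<open>\<gamma>.\<alpha>\<close>. Saturation of the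
  alphabet, which guarantees representatives, enters only through the existence of the umbrae
  \<open>\<chi>\<close> and \<open>\<delta>\<close> in \<open>cumulant\<close>.
\<close>

definition dot_product ::
    "(('a, 'r::{idom, ring_char_0}) umbral_poly \<Rightarrow> 'r) \<Rightarrow> 'a \<Rightarrow> 'a \<Rightarrow> 'a \<Rightarrow> bool" where
  "dot_product E \<gamma> \<alpha> \<delta> \<longleftrightarrow> gen_fun E \<delta> = gen_fun E \<gamma> oo fps_log (gen_fun E \<alpha>)"

definition singleton_umbra ::
    "(('a, 'r::{idom, ring_char_0}) umbral_poly \<Rightarrow> 'r) \<Rightarrow> 'a \<Rightarrow> bool" where
  "singleton_umbra E \<chi> \<longleftrightarrow> (\<forall>n\<ge>1. E (umbra \<chi> ^ n) = (if n = 1 then 1 else 0))"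

definition cumulant ::
    "(('a, 'r::{idom, ring_char_0}) umbral_poly \<Rightarrow> 'r) \<Rightarrow> 'a \<Rightarrow> 'a \<Rightarrow> bool" where
  "cumulant E \<alpha> \<kappa> \<longleftrightarrow>
    (\<exists>\<chi> \<delta>. singleton_umbra E \<chi> \<and> dot_product E \<chi> \<alpha> \<delta> \<and> similar E \<kappa> \<delta>)"

end

theory Submission
  imports Defs
begin

text \<open>
  If \<open>f\<close> is the generating function of \<open>\<alpha>\<close>, then \<open>\<kappa>\<^sub>\<alpha>\<close> has generating function \<open>g = 1 + log f\<close>, so
  \<open>f' = g' f\<close>. Comparing coefficients of \<open>t\<^bsup>n-1\<^esup>/(n-1)!\<close> yields the recurrence
  \<open>a\<^sub>n = \<Sum>j. (n-1 choose j) k\<^bsub>j+1\<^esub> a\<^bsub>n-1-j\<^esub>\<close>, and its right-hand side is the evaluation of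
  \<open>\<kappa> (\<kappa> + \<alpha>)\<^bsup>n-1\<^esup>\<close>, expanded binomially, because \<open>\<kappa>\<close> and \<open>\<alpha>\<close> are uncorrelated.
\<close>

text \<open>Chain rule: the derivative \<open>inverse (1 + fps_X)\<close> of
  \<open>fps_ln 1\<close>, composed with \<open>f - 1\<close>, is \<open>inverse f\<close>. Constant
  term 1 makes \<open>f - 1\<close> composable and \<open>f\<close> invertible.\<close>

lemma fps_deriv_fps_log:
  fixes f :: "'k::field_char_0 fps"
  assumes "fps_nth f 0 = 1"
  shows "fps_deriv (fps_log f) * f = fps_deriv f"
proof -
  have f0: "fps_nth (f - 1) 0 = 0"
    using assms by simp
  have "inverse (1 + fps_X) oo (f - 1) = inverse ((1 + fps_X) oo (f - 1))"
    by (rule fps_inverse_compose) (use f0 in simp_all)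
  also have "(1 + fps_X) oo (f - 1) = f"
    using f0 by (simp add: fps_compose_add_distrib)
  finally have "fps_deriv (fps_log f) = inverse f * fps_deriv f"
    unfolding fps_log_def
    by (simp add: fps_compose_deriv [OF f0] fps_ln_deriv fps_deriv_sub)
  moreover have "inverse f * f = 1"
    using assms by (simp add: inverse_mult_eq_1)
  ultimately show ?thesis
    by (simp add: ac_simps)
qed

context evaluation
begin

lemma zero: "E 0 = 0"
  using add [of 0 0] by simp

lemma sum: "E (\<Sum>i\<in>I. p i) = (\<Sum>i\<in>I. E (p i))"
  by (induction I rule: infinite_finite_induct) (simp_all add: zero add)

lemma of_nat_mult: "E (of_nat m * p) = of_nat m * E p"
  by (induction m) (simp_all add: zero add algebra_simps)

lemma mult_powers:
  assumes "\<kappa> \<noteq> \<alpha>"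
  shows "E (umbra \<kappa> ^ i * umbra \<alpha> ^ j) = moment E \<kappa> i * moment E \<alpha> j"
  \<comment> \<open>Distinctness keeps the two exponents apart and splits the product over the set
    into two factors.\<close>
  using uncorrelated [of "{\<kappa>, \<alpha>}" "\<lambda>x. if x = \<kappa> then i else j"] assms
  by (simp add: moment_def)

lemma mult_power_add:
  assumes "\<kappa> \<noteq> \<alpha>"
  shows "E (umbra \<kappa> * (umbra \<kappa> + umbra \<alpha>) ^ m) =
    (\<Sum>j\<le>m. of_nat (m choose j) * (moment E \<kappa> (Suc j) * moment E \<alpha> (m - j)))"
proof -
  have "E (umbra \<kappa> * (umbra \<kappa> + umbra \<alpha>) ^ m) =
      E (\<Sum>j\<le>m. of_nat (m choose j) * (umbra \<kappa> ^ Suc j * umbra \<alpha> ^ (m - j)))"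
    by (simp add: binomial_ring sum_distrib_left mult_ac)
  then show ?thesis
    by (simp only: sum of_nat_mult mult_powers [OF assms])
qed

text \<open>The separate constant term 1 fits the general formula because
  \<open>E 1 = 1\<close>.\<close>

lemma gen_fun_nth: "fps_nth (gen_fun E \<alpha>) n = to_fract (moment E \<alpha> n) / fact n"
  by (simp add: gen_fun_def moment_def one)

lemma gen_fun_singleton_umbra:
  assumes "singleton_umbra E \<chi>"
  shows "gen_fun E \<chi> = 1 + fps_X"
  using assms
  by (intro fps_ext) (auto simp: gen_fun_def moment_def singleton_umbra_def fps_X_def)

lemma gen_fun_similar: "similar E \<alpha> \<gamma> \<Longrightarrow> gen_fun E \<alpha> = gen_fun E \<gamma>"
  by (intro fps_ext) (simp add: similar_def umbrally_equivalent_def gen_fun_nth moment_def)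

lemma gen_fun_cumulant:
  assumes "cumulant E \<alpha> \<kappa>"
  shows "gen_fun E \<kappa> = 1 + fps_log (gen_fun E \<alpha>)"
proof -
  \<comment> \<open>Zero constant term ensures that composing \<open>fps_X\<close> with the
    logarithm returns the logarithm.\<close>
  have "fps_nth (fps_log (gen_fun E \<alpha>)) 0 = 0"
    by (simp add: fps_log_def fps_ln_def)
  then show ?thesis
    using assms
    by (auto simp: cumulant_def dot_product_def gen_fun_similar gen_fun_singleton_umbra
        fps_compose_add_distrib)
qed

lemma moment_Suc_cumulant:
  assumes "cumulant E \<alpha> \<kappa>"
  shows "moment E \<alpha> (Suc m) =
    (\<Sum>j\<le>m. of_nat (m choose j) * (moment E \<kappa> (Suc j) * moment E \<alpha> (m - j)))"
proof -
  let ?a = "\<lambda>n. to_fract (moment E \<alpha> n)"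
    and ?k = "\<lambda>n. to_fract (moment E \<kappa> n)"
  \<comment> \<open>The factor \<open>Suc n\<close> from differentiation cancels in
    \<open>fact (Suc n)\<close>; keeping \<open>of_nat (Suc n)\<close> unexpanded lets this
    happen.\<close>
  have deriv_nth: "fps_nth (fps_deriv (gen_fun E \<gamma>)) n = to_fract (moment E \<gamma> (Suc n)) / fact n"
    for \<gamma> n
    by (simp add: gen_fun_nth del: of_nat_Suc)
  have "fps_deriv (gen_fun E \<kappa>) * gen_fun E \<alpha> = fps_deriv (gen_fun E \<alpha>)"
    using fps_deriv_fps_log [of "gen_fun E \<alpha>"]
    by (simp add: gen_fun_cumulant [OF assms] gen_fun_nth moment_def one)
  then have "?a (Suc m) / fact m = (\<Sum>j\<le>m. (?k (Suc j) / fact j) * (?a (m - j) / fact (m - j)))"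
    by (metis (no_types, lifting) deriv_nth fps_mult_nth gen_fun_nth atLeast0AtMost sum.cong)
  then have "?a (Suc m) =
      (\<Sum>j\<le>m. fact m * ((?k (Suc j) / fact j) * (?a (m - j) / fact (m - j))))"
    by (simp add: field_simps sum_distrib_left)
  also have "\<dots> = (\<Sum>j\<le>m. of_nat (m choose j) * (?k (Suc j) * ?a (m - j)))"
    by (intro sum.cong) (auto simp: binomial_fact field_simps)
  \<comment> \<open>With the binomial coefficients also written as images of
    \<open>to_fract\<close>, its injectivity brings the identity back to the ground ring.\<close>
  also have "\<dots> = to_fract
      (\<Sum>j\<le>m. of_nat (m choose j) * (moment E \<kappa> (Suc j) * moment E \<alpha> (m - j)))"
    by (simp add: to_fract_sum to_fract_def [of "of_nat _"] of_nat_fract)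
  finally show ?thesis
    by (simp only: to_fract_eq_iff)
qed

end

theorem corollary4p12:
  fixes E :: "('a, 'r::{idom, ring_char_0}) umbral_poly \<Rightarrow> 'r"
    and \<alpha> \<kappa> :: 'a
    and n :: nat
  assumes "evaluation E"
    and "cumulant E \<alpha> \<kappa>"
    and "\<kappa> \<noteq> \<alpha>"
    and "n \<ge> 1"
  shows "umbrally_equivalent E
           (umbra \<alpha> ^ n) (umbra \<kappa> * (umbra \<kappa> + umbra \<alpha>) ^ (n - 1))"
proof -
  obtain m where "n = Suc m"
    using \<open>n \<ge> 1\<close> by (cases n) auto
  then show ?thesis
    using evaluation.moment_Suc_cumulant [OF assms(1,2), of m]
      evaluation.mult_power_add [OF assms(1,3), of m]
    by (simp add: umbrally_equivalent_def moment_def)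
qed

end
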